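(* Let $\mathbb{K}=\mathbb{R}$ or $\mathbb{K}=\mathbb{C}$, let $m\ge 1$ be an integer, and let $f$ be a $\mathbb{K}$-valued function that is at least $m+2$ times differentiable in a neighborhood in $\mathbb{K}$ of a point $\alpha$ which is a zero of $f$ of known multiplicity $m$ (that is, $f(\alpha)=f'(\alpha)=\cdots=f^{(m-1)}(\alpha)=0$ and $f^{(m)}(\alpha)\neq 0$). Let $p\in\mathbb{K}$ be a fixed parameter. Put $$u(x)=\frac{f(x)}{f'(x)},\qquad A_2(x)=\frac{f''(x)}{2f'(x)},\qquad B_r=\frac{f^{(r)}(\alpha)}{r!}.$$ Then, if the initial approximation $x_0$ is sufficiently close to $\alpha$, the iterative method $$x_{k+1}=x_k-\frac{2m\,u(x_k)\bigl(1+m\,p\,u(x_k)\bigr)}{1+m+2m\bigl(p-A_2(x_k)\bigr)u(x_k)}\qquad(k=0,1,2,\ldots)$$ is cubically convergent to $\alpha$, and its asymptotic error constant is $$\lim_{k\to\infty}\left|\frac{x_{k+1}-\alpha}{(x_k-\alpha)^3}\right|=\left|\frac{p\,B_{m+1}}{m\,B_m}-\frac{B_{m+2}}{m\,B_m}+\frac{(m+1)\,B_{m+1}^2}{2m^2\,B_m^2}\right|.$$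
   Context: Cubic convergence is understood in the sense that $x_k\to\alpha$ and $|x_{k+1}-\alpha|=O(|x_k-\alpha|^3)$; the constant in the displayed limit may vanish for special values of $p$. The iteration function is considered at points $x\neq\alpha$ near $\alpha$ (where $f'(x)\neq0$) and is extended by the value $\alpha$ at $x=\alpha$; the limit is understood for sequences with $x_k\neq\alpha$ for all $k$. *)

theory Defs
  imports "HOL-Analysis.Analysis" "HOL-Library.Landau_Symbols"
begin

definition times_differentiable_on ::
    "nat \<Rightarrow> ('a::real_normed_field \<Rightarrow> 'a) \<Rightarrow> 'a set \<Rightarrow> bool" where
  "times_differentiable_on n f U \<longleftrightarrow>
     (\<forall>j<n. \<forall>x\<in>U. ((deriv ^^ j) f) field_differentiable (at x))"

definition zero_of_multiplicity ::
    "('a::real_normed_field \<Rightarrow> 'a) \<Rightarrow> 'a \<Rightarrow> nat \<Rightarrow> bool" where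
  "zero_of_multiplicity f \<alpha> m \<longleftrightarrow>
     (\<forall>j<m. (deriv ^^ j) f \<alpha> = 0) \<and> (deriv ^^ m) f \<alpha> \<noteq> 0"

definition taylor_coeff :: "('a::real_normed_field \<Rightarrow> 'a) \<Rightarrow> 'a \<Rightarrow> nat \<Rightarrow> 'a" where
  "taylor_coeff f \<alpha> r = (deriv ^^ r) f \<alpha> / fact r"

definition newton_quot :: "('a::real_normed_field \<Rightarrow> 'a) \<Rightarrow> 'a \<Rightarrow> 'a" where
  "newton_quot f x = f x / deriv f x"

definition A2 :: "('a::real_normed_field \<Rightarrow> 'a) \<Rightarrow> 'a \<Rightarrow> 'a" where
  "A2 f x = (deriv ^^ 2) f x / (2 * deriv f x)"

definition step_denom ::
    "('a::real_normed_field \<Rightarrow> 'a) \<Rightarrow> nat \<Rightarrow> 'a \<Rightarrow> 'a \<Rightarrow> 'a" where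
  "step_denom f m p x =
     1 + of_nat m + 2 * of_nat m * (p - A2 f x) * newton_quot f x"

(* The quotients defining the step make no sense at \<alpha> itself when m > 1;
   the iteration function is extended there by the value \<alpha>. *)
definition iter_step ::
    "('a::real_normed_field \<Rightarrow> 'a) \<Rightarrow> 'a \<Rightarrow> nat \<Rightarrow> 'a \<Rightarrow> 'a \<Rightarrow> 'a" where
  "iter_step f \<alpha> m p x =
     (if x = \<alpha> then \<alpha>
      else x - 2 * of_nat m * newton_quot f x * (1 + of_nat m * p * newton_quot f x)
                 / step_denom f m p x)"

(* Division is total in HOL, so it has to be said separately that the iterates
   stay where f is differentiable and that no step divides by zero. *)
definition well_defined_iterates ::
    "('a::real_normed_field \<Rightarrow> 'a) \<Rightarrow> 'a set \<Rightarrow> 'a \<Rightarrow> nat \<Rightarrow> 'a \<Rightarrow> (nat \<Rightarrow> 'a) \<Rightarrow> bool" where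
  "well_defined_iterates f U \<alpha> m p x \<longleftrightarrow>
     (\<forall>k. x k \<in> U \<and>
          (x k \<noteq> \<alpha> \<longrightarrow> deriv f (x k) \<noteq> 0 \<and> step_denom f m p (x k) \<noteq> 0))"

definition cubically_convergent :: "(nat \<Rightarrow> 'a::real_normed_field) \<Rightarrow> 'a \<Rightarrow> bool" where
  "cubically_convergent x \<alpha> \<longleftrightarrow>
     x \<longlonglongrightarrow> \<alpha> \<and>
     (\<lambda>k. norm (x (Suc k) - \<alpha>)) \<in> O(\<lambda>k. norm (x k - \<alpha>) ^ 3)"

end

theory Submission
  imports Defs
begin

text \<open>
  Put \<open>h = x - \<alpha>\<close>. A zero of multiplicity \<open>m\<close> allows the common power \<open>h ^ m\<close> to be split off
  from \<open>f\<close>, \<open>h * f'\<close> and \<open>h\<^sup>2 * f''\<close>, leaving factors \<open>F\<close>, \<open>G\<close>, \<open>H\<close> that are known up to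
  \<open>o(h\<^sup>2)\<close> (\<open>expansion_at_zero\<close>). In these terms \<open>u = h F / G\<close> and \<open>2 A\<^sub>2 u = H F / G\<^sup>2\<close>, so the
  powers of \<open>h\<close> cancel: the denominator of the step tends to \<open>1 + m - (m - 1) = 2\<close>, and the error
  after one step is \<open>h N / (G\<^sup>2 D)\<close>, where \<open>D\<close> is that denominator and \<open>N\<close> is a polynomial in
  \<open>F\<close>, \<open>G\<close>, \<open>H\<close> and \<open>h\<close>. The constants of the method are chosen so that the terms of orders
  \<open>0\<close> and \<open>1\<close> of \<open>N\<close> cancel (\<open>numerator_factorization\<close>); the coefficient of \<open>h\<^sup>2\<close>, divided by the
  limit \<open>2 m\<^sup>2 B\<^sub>m\<^sup>2\<close> of \<open>G\<^sup>2 D\<close>, is the asymptotic error constant (\<open>iter_step_error\<close>). Once the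
  quotient of the new error by the cube of the old one has a limit, cubic convergence from nearby
  starting points is a contraction argument (\<open>local_cubic_convergence\<close>).

  The derivative of order \<open>m + 2\<close> need not be continuous, so the expansions come from Taylor's
  theorem with Peano's form of the remainder. It is proved here by integrating little-o estimates
  with the mean value inequality, which holds in every real normed field. The real and the
  complex case are therefore instances of the same lemma.
\<close>

section \<open>Taylor's theorem with Peano remainder\<close>

text \<open>
  By the mean value inequality on the ball around \<open>\<alpha>\<close> with radius \<open>norm (x - \<alpha>)\<close>, a bound
  for \<open>g'\<close> of order \<open>n\<close> becomes one for \<open>g\<close> of order \<open>n + 1\<close>. The limit says nothing about the
  centre of that ball, where the bound on \<open>g'\<close> is needed as well; hence the hypothesis \<open>g' \<alpha> = 0\<close>.
\<close>

lemma little_o_of_deriv: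
  fixes g g' :: "'a::real_normed_field \<Rightarrow> 'a"
  assumes "r > 0" and der: "\<And>z. z \<in> ball \<alpha> r \<Longrightarrow> (g has_field_derivative g' z) (at z)"
    and g0: "g \<alpha> = 0" and g'0: "g' \<alpha> = 0"
    and lim: "((\<lambda>x. g' x / (x - \<alpha>) ^ n) \<longlongrightarrow> 0) (at \<alpha>)"
  shows "((\<lambda>x. g x / (x - \<alpha>) ^ Suc n) \<longlongrightarrow> 0) (at \<alpha>)"
proof (rule tendstoI)
  fix e :: real
  assume "e > 0"
  then have "e / 2 > 0"
    by simp
  from tendstoD[OF lim this] obtain d where "d > 0"
    and d: "\<And>x. x \<noteq> \<alpha> \<Longrightarrow> dist x \<alpha> < d \<Longrightarrow> norm (g' x / (x - \<alpha>) ^ n) < e / 2"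
    by (auto simp: eventually_at)
  have g'_le: "norm (g' z) \<le> e / 2 * norm (z - \<alpha>) ^ n" if "dist z \<alpha> < d" for z
  proof (cases "z = \<alpha>")
    case True
    then show ?thesis
      using g'0 \<open>e > 0\<close> by simp
  next
    case False
    then show ?thesis
      using d[OF False that] by (simp add: norm_divide norm_power field_simps)
  qed
  have g_less: "norm (g x / (x - \<alpha>) ^ Suc n) < e" if "x \<noteq> \<alpha>" "dist x \<alpha> < min d r" for x
  proof -
    let ?S = "cball \<alpha> (norm (x - \<alpha>))"
    have S: "dist z \<alpha> < d" "z \<in> ball \<alpha> r" "norm (z - \<alpha>) \<le> norm (x - \<alpha>)" if "z \<in> ?S" for z
      using that \<open>dist x \<alpha> < min d r\<close> by (auto simp: dist_norm norm_minus_commute)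
    have "norm (g x - g \<alpha>) \<le> e / 2 * norm (x - \<alpha>) ^ n * norm (x - \<alpha>)"
    proof (rule field_differentiable_bound[where S = ?S and f' = g'])
      fix z assume z: "z \<in> ?S"
      show "(g has_field_derivative g' z) (at z within ?S)"
        using der[OF S(2)[OF z]] by (rule has_field_derivative_at_within)
      have "norm (g' z) \<le> e / 2 * norm (z - \<alpha>) ^ n"
        using g'_le S(1)[OF z] .
      also have "\<dots> \<le> e / 2 * norm (x - \<alpha>) ^ n"
        using S(3)[OF z] \<open>e > 0\<close> by (intro mult_left_mono power_mono) auto
      finally show "norm (g' z) \<le> e / 2 * norm (x - \<alpha>) ^ n" .
    qed (auto simp: dist_norm norm_minus_commute)
    then have "norm (g x) \<le> e / 2 * norm (x - \<alpha>) ^ Suc n"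
      using g0 by (simp add: mult_ac)
    also have "\<dots> < e * norm (x - \<alpha>) ^ Suc n"
      using \<open>e > 0\<close> \<open>x \<noteq> \<alpha>\<close> by (intro mult_strict_right_mono) auto
    finally show ?thesis
      using \<open>x \<noteq> \<alpha>\<close> by (simp add: norm_divide norm_power divide_less_eq del: power_Suc)
  qed
  then show "eventually (\<lambda>x. dist (g x / (x - \<alpha>) ^ Suc n) 0 < e) (at \<alpha>)"
    unfolding eventually_at using \<open>d > 0\<close> \<open>r > 0\<close> by (intro exI[of _ "min d r"]) auto
qed

lemma taylor_coeff_deriv:
  "taylor_coeff (deriv f) \<alpha> j = of_nat (Suc j) * taylor_coeff f \<alpha> (Suc j)"
proof -
  have "(of_nat (Suc j) :: 'a) \<noteq> 0"
    by (simp only: of_nat_eq_0_iff)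
  then show ?thesis
    by (simp add: taylor_coeff_def funpow_swap1 fact_Suc del: of_nat_Suc)
qed

lemma times_differentiable_on_deriv:
  "times_differentiable_on (Suc n) f U \<Longrightarrow> times_differentiable_on n (deriv f) U"
  unfolding times_differentiable_on_def
  by (metis Suc_mono comp_apply funpow_Suc_right)

text \<open>
  The induction passes from \<open>f\<close> to \<open>f'\<close>, whose Taylor polynomial is the derivative of that of
  \<open>f\<close>. It starts at the first-order expansion, which is differentiability at the point \<open>\<alpha>\<close>; thus
  the highest derivative enters only through its value at \<open>\<alpha>\<close>.
\<close>

lemma taylor_little_o:
  fixes f :: "'a::real_normed_field \<Rightarrow> 'a"
  assumes "open U" "\<alpha> \<in> U" "times_differentiable_on (Suc n) f U"
  shows "((\<lambda>x. (f x - (\<Sum>j\<le>Suc n. taylor_coeff f \<alpha> j * (x - \<alpha>) ^ j)) / (x - \<alpha>) ^ Suc n)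
           \<longlongrightarrow> 0) (at \<alpha>)"
  using assms(3)
proof (induction n arbitrary: f)
  case 0
  then have "(f has_field_derivative deriv f \<alpha>) (at \<alpha>)"
    using \<open>\<alpha> \<in> U\<close> by (simp add: times_differentiable_on_def field_differentiable_derivI)
  then have "((\<lambda>x. (f x - f \<alpha>) / (x - \<alpha>) - deriv f \<alpha>) \<longlongrightarrow> deriv f \<alpha> - deriv f \<alpha>) (at \<alpha>)"
    unfolding has_field_derivative_iff by (intro tendsto_intros)
  then have "((\<lambda>x. (f x - f \<alpha>) / (x - \<alpha>) - deriv f \<alpha>) \<longlongrightarrow> 0) (at \<alpha>)"
    by simp
  moreover have "\<forall>\<^sub>F x in at \<alpha>. (f x - f \<alpha>) / (x - \<alpha>) - deriv f \<alpha> =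
      (f x - (\<Sum>j\<le>Suc 0. taylor_coeff f \<alpha> j * (x - \<alpha>) ^ j)) / (x - \<alpha>) ^ Suc 0"
    by (auto simp: eventually_at_filter taylor_coeff_def diff_divide_distrib add_divide_distrib)
  ultimately show ?case
    by (rule Lim_transform_eventually)
next
  case (Suc n)
  let ?B = "taylor_coeff f \<alpha>"
  let ?T' = "\<lambda>x. \<Sum>j\<le>Suc n. taylor_coeff (deriv f) \<alpha> j * (x - \<alpha>) ^ j"
  obtain r where "r > 0" and r: "ball \<alpha> r \<subseteq> U"
    using \<open>open U\<close> \<open>\<alpha> \<in> U\<close> by (auto simp: open_contains_ball)
  show ?case
  proof (rule little_o_of_deriv[OF \<open>r > 0\<close>])
    fix z assume "z \<in> ball \<alpha> r"
    then have f: "(f has_field_derivative deriv f z) (at z)"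
      using r Suc.prems
      by (force simp: times_differentiable_on_def intro!: field_differentiable_derivI dest: spec[of _ 0])
    have "((\<lambda>x. \<Sum>j\<le>Suc (Suc n). ?B j * (x - \<alpha>) ^ j) has_field_derivative
            (\<Sum>j\<le>Suc (Suc n). ?B j * (of_nat j * (z - \<alpha>) ^ (j - 1)))) (at z)"
    proof (rule DERIV_sum)
      fix j
      show "((\<lambda>x. ?B j * (x - \<alpha>) ^ j) has_field_derivative
              ?B j * (of_nat j * (z - \<alpha>) ^ (j - 1))) (at z)"
        by (rule derivative_eq_intros refl | simp)+
    qed
    also have "(\<Sum>j\<le>Suc (Suc n). ?B j * (of_nat j * (z - \<alpha>) ^ (j - 1))) = ?T' z"
      by (subst sum.atMost_Suc_shift) (simp add: taylor_coeff_deriv mult_ac del: sum.atMost_Suc of_nat_Suc)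
    finally show "((\<lambda>x. f x - (\<Sum>j\<le>Suc (Suc n). ?B j * (x - \<alpha>) ^ j)) has_field_derivative
                   deriv f z - ?T' z) (at z)"
      using f by (intro DERIV_diff)
  next
    show "f \<alpha> - (\<Sum>j\<le>Suc (Suc n). ?B j * (\<alpha> - \<alpha>) ^ j) = 0"
      by (subst sum.atMost_Suc_shift) (simp add: taylor_coeff_def del: sum.atMost_Suc)
    show "deriv f \<alpha> - ?T' \<alpha> = 0"
      by (subst sum.atMost_Suc_shift) (simp add: taylor_coeff_def del: sum.atMost_Suc)
    show "((\<lambda>x. (deriv f x - ?T' x) / (x - \<alpha>) ^ Suc n) \<longlongrightarrow> 0) (at \<alpha>)"
      using Suc.IH[OF times_differentiable_on_deriv[OF Suc.prems]] .
  qed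
qed

text \<open>
  The same expansion, read as a limit: the last coefficient is traded for a function of \<open>x\<close>
  that tends to it. In this form Taylor expansions become exact identities at points \<open>x \<noteq> \<alpha>\<close>.
\<close>

lemma taylor_next_coeff:
  fixes f :: "'a::real_normed_field \<Rightarrow> 'a"
  assumes "open U" "\<alpha> \<in> U" "times_differentiable_on (Suc n) f U"
  shows "((\<lambda>x. (f x - (\<Sum>j\<le>n. taylor_coeff f \<alpha> j * (x - \<alpha>) ^ j)) / (x - \<alpha>) ^ Suc n)
           \<longlongrightarrow> taylor_coeff f \<alpha> (Suc n)) (at \<alpha>)"
proof -
  let ?T = "\<lambda>x. \<Sum>j\<le>n. taylor_coeff f \<alpha> j * (x - \<alpha>) ^ j"
  have "((\<lambda>x. (f x - (?T x + taylor_coeff f \<alpha> (Suc n) * (x - \<alpha>) ^ Suc n)) / (x - \<alpha>) ^ Suc n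
           + taylor_coeff f \<alpha> (Suc n)) \<longlongrightarrow> 0 + taylor_coeff f \<alpha> (Suc n)) (at \<alpha>)"
    using taylor_little_o[OF assms] by (intro tendsto_intros) simp
  then show ?thesis
    by (rule Lim_transform_eventually[where f = "\<lambda>x. _ x", THEN tendsto_eq_rhs])
      (auto simp: eventually_at_filter diff_divide_distrib add_divide_distrib)
qed

text \<open>
  Multiplying the derivative of order \<open>r\<close> by \<open>(x - \<alpha>) ^ r\<close> turns termwise differentiation into
  multiplication of the coefficient of index \<open>j\<close> by the falling factorial
  \<open>j (j - 1) \<dots> (j - r + 1)\<close>, here \<open>fact r * (j choose r)\<close>. All derivatives then share one range
  of summation, since the coefficients with \<open>j < r\<close> vanish.
\<close>

lemma taylor_next_coeff_deriv:
  fixes f :: "'a::real_normed_field \<Rightarrow> 'a"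
  assumes "open U" "\<alpha> \<in> U" "times_differentiable_on (Suc n) f U" "r \<le> n"
  defines "E \<equiv> \<lambda>j. of_nat (fact r * (j choose r)) * taylor_coeff f \<alpha> j"
  shows "((\<lambda>x. ((x - \<alpha>) ^ r * (deriv ^^ r) f x - (\<Sum>j\<le>n. E j * (x - \<alpha>) ^ j)) / (x - \<alpha>) ^ Suc n)
           \<longlongrightarrow> E (Suc n)) (at \<alpha>)"
proof -
  let ?g = "(deriv ^^ r) f"
  have "times_differentiable_on (Suc n - r) ?g U"
    using assms(3) unfolding times_differentiable_on_def
    by (metis (no_types, opaque_lifting) comp_apply funpow_add less_diff_conv)
  then have "times_differentiable_on (Suc (n - r)) ?g U"
    using \<open>r \<le> n\<close> by (simp add: Suc_diff_le)
  note lim = taylor_next_coeff[OF assms(1,2) this]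
  have coeff: "taylor_coeff ?g \<alpha> j = E (r + j)" for j
  proof -
    have "(deriv ^^ j) ?g \<alpha> = (deriv ^^ (r + j)) f \<alpha>"
      by (metis add.commute comp_apply funpow_add)
    moreover have "of_nat (fact r * ((r + j) choose r)) * (fact j :: 'a) = fact (r + j)"
      using binomial_fact_lemma[of r "r + j"]
      by (metis (no_types, lifting) add_diff_cancel_left' le_add1 mult.assoc mult.commute of_nat_fact of_nat_mult)
    ultimately show ?thesis
      unfolding taylor_coeff_def E_def
      by (simp add: field_simps del: of_nat_mult)
  qed
  have sum: "(\<Sum>j\<le>n. E j * h ^ j) = h ^ r * (\<Sum>j\<le>n - r. taylor_coeff ?g \<alpha> j * h ^ j)" for h
  proof -
    have "(\<Sum>j\<le>n. E j * h ^ j) = (\<Sum>j\<in>{r..n}. E j * h ^ j)"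
      by (intro sum.mono_neutral_right) (auto simp: E_def not_le)
    also have "\<dots> = (\<Sum>j\<le>n - r. E (r + j) * h ^ (r + j))"
      by (rule sum.reindex_bij_witness[where i = "\<lambda>j. r + j" and j = "\<lambda>j. j - r"])
        (use \<open>r \<le> n\<close> in auto)
    finally show ?thesis
      by (simp add: coeff sum_distrib_left power_add mult_ac)
  qed
  have "taylor_coeff ?g \<alpha> (Suc (n - r)) = E (Suc n)"
    using \<open>r \<le> n\<close> by (simp add: coeff)
  then have "((\<lambda>x. (?g x - (\<Sum>j\<le>n - r. taylor_coeff ?g \<alpha> j * (x - \<alpha>) ^ j)) / (x - \<alpha>) ^ Suc (n - r))
        \<longlongrightarrow> E (Suc n)) (at \<alpha>)"
    using lim by simp
  moreover have "\<forall>\<^sub>F x in at \<alpha>.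
      (?g x - (\<Sum>j\<le>n - r. taylor_coeff ?g \<alpha> j * (x - \<alpha>) ^ j)) / (x - \<alpha>) ^ Suc (n - r) =
      ((x - \<alpha>) ^ r * ?g x - (\<Sum>j\<le>n. E j * (x - \<alpha>) ^ j)) / (x - \<alpha>) ^ Suc n"
  proof (rule eventually_at_filter[THEN iffD2], rule always_eventually, intro allI impI)
    fix x :: 'a
    assume "x \<noteq> \<alpha>"
    have "(x - \<alpha>) ^ Suc n = (x - \<alpha>) ^ r * (x - \<alpha>) ^ Suc (n - r)"
      using \<open>r \<le> n\<close> by (simp flip: power_add power_Suc)
    with \<open>x \<noteq> \<alpha>\<close> show "(?g x - (\<Sum>j\<le>n - r. taylor_coeff ?g \<alpha> j * (x - \<alpha>) ^ j)) / (x - \<alpha>) ^ Suc (n - r) =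
      ((x - \<alpha>) ^ r * ?g x - (\<Sum>j\<le>n. E j * (x - \<alpha>) ^ j)) / (x - \<alpha>) ^ Suc n"
      by (simp only: sum right_diff_distrib[symmetric] mult_divide_mult_cancel_left_if) simp
  qed
  ultimately show ?thesis
    by (rule Lim_transform_eventually)
qed

section \<open>The error of one step\<close>

text \<open>
  All coefficients below index \<open>m\<close> vanish, so two explicit terms remain besides the one whose
  coefficient \<open>c\<close> varies. The bound on \<open>r\<close> admits \<open>r = 2\<close> when \<open>m = 1\<close>, where the coefficient of
  index \<open>m\<close> is \<open>0\<close>.
\<close>

lemma expansion_at_zero:
  fixes f :: "'a::real_normed_field \<Rightarrow> 'a"
  assumes "open U" "\<alpha> \<in> U" "times_differentiable_on (m + 2) f U"
    "zero_of_multiplicity f \<alpha> m" "r \<le> m + 1"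
  defines "E \<equiv> \<lambda>j. of_nat (fact r * (j choose r)) * taylor_coeff f \<alpha> j"
  obtains c where "(c \<longlongrightarrow> E (m + 2)) (at \<alpha>)"
    "\<And>x. x \<noteq> \<alpha> \<Longrightarrow> (x - \<alpha>) ^ r * (deriv ^^ r) f x =
        (x - \<alpha>) ^ m * (E m + E (m + 1) * (x - \<alpha>) + c x * (x - \<alpha>)\<^sup>2)"
proof
  let ?c = "\<lambda>x. ((x - \<alpha>) ^ r * (deriv ^^ r) f x - (\<Sum>j\<le>m + 1. E j * (x - \<alpha>) ^ j)) / (x - \<alpha>) ^ (m + 2)"
  show "(?c \<longlongrightarrow> E (m + 2)) (at \<alpha>)"
    using taylor_next_coeff_deriv[of U \<alpha> "m + 1" f r] assms by (simp add: E_def)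
  have E0: "E j = 0" if "j < m" for j
    using that assms(4) by (simp add: E_def taylor_coeff_def zero_of_multiplicity_def)
  have sum: "(\<Sum>j\<le>m + 1. E j * h ^ j) = E m * h ^ m + E (m + 1) * h ^ (m + 1)" for h
  proof -
    have "(\<Sum>j\<le>m + 1. E j * h ^ j) = (\<Sum>j\<in>{m, m + 1}. E j * h ^ j)"
    proof (intro sum.mono_neutral_right ballI)
      fix j assume "j \<in> {..m + 1} - {m, m + 1}"
      then have "j < m"
        by force
      then show "E j * h ^ j = 0"
        using E0 by simp
    qed auto
    then show ?thesis
      by simp
  qed
  fix x assume "x \<noteq> \<alpha>"
  define h where "h = x - \<alpha>"
  with \<open>x \<noteq> \<alpha>\<close> have "h \<noteq> 0"
    by simp
  then show "(x - \<alpha>) ^ r * (deriv ^^ r) f x =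
        (x - \<alpha>) ^ m * (E m + E (m + 1) * (x - \<alpha>) + ?c x * (x - \<alpha>)\<^sup>2)"
    unfolding sum h_def[symmetric] by (simp add: field_simps power_add power2_eq_square)
qed

text \<open>
  The algebraic core of the method: the orders \<open>0\<close> and \<open>1\<close> in \<open>h\<close> cancel. For \<open>p = 0\<close> they do so
  by the choice of the constants \<open>1 + M\<close>, \<open>M\<close> and \<open>2 * M\<close>; the term with \<open>p\<close> has a factor \<open>h\<close>
  already and gains another one from \<open>G - M * F\<close>.
\<close>

lemma numerator_factorization:
  fixes a b p h C1 C2 C3 M :: "'a::comm_ring_1"
  defines "F \<equiv> a + b * h + C1 * h\<^sup>2"
    and "G \<equiv> M * a + (M + 1) * b * h + C2 * h\<^sup>2"
    and "H \<equiv> M * (M - 1) * a + M * (M + 1) * b * h + C3 * h\<^sup>2"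
  shows "(1 + M) * G\<^sup>2 - M * H * F - 2 * M * F * G + 2 * M * p * h * F * (G - M * F) =
    h\<^sup>2 * ((M + 1) * b\<^sup>2 + 2 * M\<^sup>2 * a * C2 - M\<^sup>2 * (M + 1) * a * C1 - M * a * C3
         + 2 * M * p * F * (b + (C2 - M * C1) * h)
         + h * (2 * (M\<^sup>2 + M + 1) * b * C2 - M * (M + 1) * (M + 2) * b * C1 - M * b * C3)
         + h\<^sup>2 * ((M + 1) * C2\<^sup>2 - M * C1 * C3 - 2 * M * C1 * C2))"
  unfolding F_def G_def H_def by (simp add: algebra_simps power2_eq_square)

text \<open>
  Near \<open>\<alpha>\<close> the derivative is governed by \<open>G\<close>, whose limit \<open>m B\<^sub>m\<close> is not \<open>0\<close>, and the denominator
  of the step tends to \<open>2\<close>; hence neither vanishes close to \<open>\<alpha>\<close>. The error constant is the limit of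
  the cofactor of \<open>h\<^sup>2\<close> in the numerator divided by that of \<open>G\<^sup>2 D\<close>.
\<close>

lemma
  fixes f :: "'a::real_normed_field \<Rightarrow> 'a" and p :: 'a
  assumes "m \<ge> 1" "open U" "\<alpha> \<in> U" "times_differentiable_on (m + 2) f U"
    "zero_of_multiplicity f \<alpha> m"
  defines "B \<equiv> taylor_coeff f \<alpha>"
  shows eventually_deriv_nonzero: "\<forall>\<^sub>F x in at \<alpha>. deriv f x \<noteq> 0"
    and eventually_step_denom_nonzero: "\<forall>\<^sub>F x in at \<alpha>. step_denom f m p x \<noteq> 0"
    and iter_step_error: "((\<lambda>x. (iter_step f \<alpha> m p x - \<alpha>) / (x - \<alpha>) ^ 3) \<longlongrightarrow>
      p * B (m + 1) / (of_nat m * B m) - B (m + 2) / (of_nat m * B m)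
        + (of_nat m + 1) * (B (m + 1))\<^sup>2 / (2 * (of_nat m)\<^sup>2 * (B m)\<^sup>2)) (at \<alpha>)"
      (is "(_ \<longlongrightarrow> ?L) _")
proof -
  define M :: 'a where "M = of_nat m"
  define a b c where "a = B m" and "b = B (m + 1)" and "c = B (m + 2)"
  have "M \<noteq> 0"
    using \<open>m \<ge> 1\<close> by (simp add: M_def)
  have "a \<noteq> 0"
    using assms(5) by (simp add: a_def B_def taylor_coeff_def zero_of_multiplicity_def)
  have choose2: "of_nat (2 * (n choose 2)) = (of_nat n * (of_nat n - 1) :: 'a)" for n
  proof -
    have "2 * (n choose 2) = n * (n - 1)"
      by (cases n) (simp_all add: choose_two)
    then have "of_nat (2 * (n choose 2)) = (of_nat (n * (n - 1)) :: 'a)"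
      by (rule arg_cong)
    also have "\<dots> = of_nat n * (of_nat n - 1)"
      by (cases n) (simp_all add: algebra_simps)
    finally show ?thesis .
  qed
  note expansion = expansion_at_zero[OF assms(2-5), folded B_def]
  obtain C1 where C1: "(C1 \<longlongrightarrow> c) (at \<alpha>)" and f: "\<And>x. x \<noteq> \<alpha> \<Longrightarrow>
      f x = (x - \<alpha>) ^ m * (a + b * (x - \<alpha>) + C1 x * (x - \<alpha>)\<^sup>2)"
    using expansion[of 0] unfolding a_def b_def c_def by auto
  obtain C2 where C2: "(C2 \<longlongrightarrow> (M + 2) * c) (at \<alpha>)" and f': "\<And>x. x \<noteq> \<alpha> \<Longrightarrow>
      (x - \<alpha>) * deriv f x = (x - \<alpha>) ^ m * (M * a + (M + 1) * b * (x - \<alpha>) + C2 x * (x - \<alpha>)\<^sup>2)"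
    using expansion[of 1] unfolding a_def b_def c_def M_def by (auto simp: add_ac)
  obtain C3 where C3: "(C3 \<longlongrightarrow> (M + 2) * (M + 1) * c) (at \<alpha>)" and f'': "\<And>x. x \<noteq> \<alpha> \<Longrightarrow>
      (x - \<alpha>)\<^sup>2 * (deriv ^^ 2) f x =
      (x - \<alpha>) ^ m * (M * (M - 1) * a + M * (M + 1) * b * (x - \<alpha>) + C3 x * (x - \<alpha>)\<^sup>2)"
  proof (rule expansion[of 2])
    show "2 \<le> m + 1"
      using \<open>m \<ge> 1\<close> by simp
  next
    fix C assume "(C \<longlongrightarrow> of_nat (fact 2 * ((m + 2) choose 2)) * B (m + 2)) (at \<alpha>)"
      "\<And>x. x \<noteq> \<alpha> \<Longrightarrow> (x - \<alpha>)\<^sup>2 * (deriv ^^ 2) f x =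
         (x - \<alpha>) ^ m * (of_nat (fact 2 * (m choose 2)) * B m
           + of_nat (fact 2 * ((m + 1) choose 2)) * B (m + 1) * (x - \<alpha>) + C x * (x - \<alpha>)\<^sup>2)"
    then show thesis
      by (intro that[of C]) (simp_all only: fact_2 choose2 a_def b_def c_def M_def, simp_all add: algebra_simps)
  qed
  define F where "F x = a + b * (x - \<alpha>) + C1 x * (x - \<alpha>)\<^sup>2" for x
  define G where "G x = M * a + (M + 1) * b * (x - \<alpha>) + C2 x * (x - \<alpha>)\<^sup>2" for x
  define H where "H x = M * (M - 1) * a + M * (M + 1) * b * (x - \<alpha>) + C3 x * (x - \<alpha>)\<^sup>2" for x
  \<comment> \<open>the cofactor of \<open>h\<^sup>2\<close> in the factorized numerator\<close>
  define P where "P x = (M + 1) * b\<^sup>2 + 2 * M\<^sup>2 * a * C2 x - M\<^sup>2 * (M + 1) * a * C1 x - M * a * C3 x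
         + 2 * M * p * F x * (b + (C2 x - M * C1 x) * (x - \<alpha>))
         + (x - \<alpha>) * (2 * (M\<^sup>2 + M + 1) * b * C2 x - M * (M + 1) * (M + 2) * b * C1 x - M * b * C3 x)
         + (x - \<alpha>)\<^sup>2 * ((M + 1) * (C2 x)\<^sup>2 - M * C1 x * C3 x - 2 * M * C1 x * C2 x)" for x
  \<comment> \<open>the denominator of the step after cancellation of the powers of \<open>h\<close>\<close>
  define D where "D x = 1 + M + 2 * M * p * ((x - \<alpha>) * F x / G x) - M * (H x * F x / (G x)\<^sup>2)" for x
  have F: "(F \<longlongrightarrow> a + b * (\<alpha> - \<alpha>) + c * (\<alpha> - \<alpha>)\<^sup>2) (at \<alpha>)"
    unfolding F_def by (intro tendsto_intros C1)
  have G: "(G \<longlongrightarrow> M * a + (M + 1) * b * (\<alpha> - \<alpha>) + (M + 2) * c * (\<alpha> - \<alpha>)\<^sup>2) (at \<alpha>)"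
    unfolding G_def by (intro tendsto_intros C2)
  have H: "(H \<longlongrightarrow> M * (M - 1) * a + M * (M + 1) * b * (\<alpha> - \<alpha>) + (M + 2) * (M + 1) * c * (\<alpha> - \<alpha>)\<^sup>2) (at \<alpha>)"
    unfolding H_def by (intro tendsto_intros C3)
  note F = F[simplified] and G = G[simplified] and H = H[simplified]
  have "(D \<longlongrightarrow> 1 + M + 2 * M * p * ((\<alpha> - \<alpha>) * a / (M * a)) - M * (M * (M - 1) * a * a / (M * a)\<^sup>2)) (at \<alpha>)"
    unfolding D_def using \<open>M \<noteq> 0\<close> \<open>a \<noteq> 0\<close> by (intro tendsto_intros F G H) auto
  also have "1 + M + 2 * M * p * ((\<alpha> - \<alpha>) * a / (M * a)) - M * (M * (M - 1) * a * a / (M * a)\<^sup>2) = 2"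
    using \<open>M \<noteq> 0\<close> \<open>a \<noteq> 0\<close> by (simp add: field_simps power2_eq_square)
  finally have D: "(D \<longlongrightarrow> 2) (at \<alpha>)" .
  have "(P \<longlongrightarrow> (M + 1) * b\<^sup>2 + 2 * M\<^sup>2 * a * ((M + 2) * c) - M\<^sup>2 * (M + 1) * a * c - M * a * ((M + 2) * (M + 1) * c)
         + 2 * M * p * a * (b + ((M + 2) * c - M * c) * (\<alpha> - \<alpha>))
         + (\<alpha> - \<alpha>) * (2 * (M\<^sup>2 + M + 1) * b * ((M + 2) * c) - M * (M + 1) * (M + 2) * b * c - M * b * ((M + 2) * (M + 1) * c))
         + (\<alpha> - \<alpha>)\<^sup>2 * ((M + 1) * ((M + 2) * c)\<^sup>2 - M * c * ((M + 2) * (M + 1) * c) - 2 * M * c * ((M + 2) * c))) (at \<alpha>)"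
    unfolding P_def by (intro tendsto_intros F C1 C2 C3)
  then have P: "(P \<longlongrightarrow> (M + 1) * b\<^sup>2 - 2 * M * a * c + 2 * M * p * a * b) (at \<alpha>)"
    by (rule tendsto_eq_rhs) (simp add: algebra_simps power2_eq_square)
  have "((\<lambda>x. P x / ((G x)\<^sup>2 * D x)) \<longlongrightarrow>
      ((M + 1) * b\<^sup>2 - 2 * M * a * c + 2 * M * p * a * b) / ((M * a)\<^sup>2 * 2)) (at \<alpha>)"
    using \<open>M \<noteq> 0\<close> \<open>a \<noteq> 0\<close> by (intro tendsto_intros P G D) auto
  also have "((M + 1) * b\<^sup>2 - 2 * M * a * c + 2 * M * p * a * b) / ((M * a)\<^sup>2 * 2) = ?L"
    unfolding a_def[symmetric] b_def[symmetric] c_def[symmetric] M_def[symmetric]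
    using \<open>M \<noteq> 0\<close> \<open>a \<noteq> 0\<close> by (simp add: field_simps power2_eq_square)
  finally have lim: "((\<lambda>x. P x / ((G x)\<^sup>2 * D x)) \<longlongrightarrow> ?L) (at \<alpha>)" .

  have ne: "\<forall>\<^sub>F x in at \<alpha>. x \<noteq> \<alpha> \<and> G x \<noteq> 0 \<and> D x \<noteq> 0"
    using tendsto_imp_eventually_ne[OF G, of 0] tendsto_imp_eventually_ne[OF D, of 0]
      \<open>M \<noteq> 0\<close> \<open>a \<noteq> 0\<close>
    by (intro eventually_conj) (auto simp: eventually_at_filter)
  have deriv_eq: "deriv f x = (x - \<alpha>) ^ m * G x / (x - \<alpha>)" if "x \<noteq> \<alpha>" for x
    using f'[OF that] that by (simp add: G_def field_simps)
  have quot: "newton_quot f x = (x - \<alpha>) * F x / G x" if "x \<noteq> \<alpha>" for x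
    using that by (simp add: newton_quot_def deriv_eq f[OF that, folded F_def])
  have deriv2_eq: "(deriv ^^ 2) f x = (x - \<alpha>) ^ m * H x / (x - \<alpha>)\<^sup>2" if "x \<noteq> \<alpha>" for x
    using f''[OF that] that by (simp add: H_def field_simps)
  have A2_quot: "2 * (A2 f x * newton_quot f x) = H x * F x / (G x)\<^sup>2" if "x \<noteq> \<alpha>" for x
  proof -
    define h where "h = x - \<alpha>"
    with that have "h \<noteq> 0"
      by simp
    then show ?thesis
      unfolding A2_def deriv2_eq[OF that] deriv_eq[OF that] quot[OF that] h_def[symmetric]
      by (cases "G x = 0") (simp_all add: field_simps power2_eq_square)
  qed
  have denom: "step_denom f m p x = D x" if "x \<noteq> \<alpha>" for x
  proof -
    have "step_denom f m p x = 1 + M + 2 * M * p * newton_quot f x - M * (2 * (A2 f x * newton_quot f x))"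
      by (simp add: step_denom_def M_def algebra_simps)
    then show ?thesis
      unfolding A2_quot[OF that] unfolding quot[OF that] D_def .
  qed
  show "\<forall>\<^sub>F x in at \<alpha>. deriv f x \<noteq> 0"
    using ne by eventually_elim (simp add: deriv_eq)
  show "\<forall>\<^sub>F x in at \<alpha>. step_denom f m p x \<noteq> 0"
    using ne by eventually_elim (simp add: denom)
  have "\<forall>\<^sub>F x in at \<alpha>. P x / ((G x)\<^sup>2 * D x) = (iter_step f \<alpha> m p x - \<alpha>) / (x - \<alpha>) ^ 3"
    using ne
  proof eventually_elim
    case (elim x)
    define h where "h = x - \<alpha>"
    have "h \<noteq> 0" "G x \<noteq> 0" "D x \<noteq> 0"
      using elim by (auto simp: h_def)
    have GD: "(G x)\<^sup>2 * D x = (1 + M) * (G x)\<^sup>2 + 2 * M * p * h * F x * G x - M * H x * F x"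
      using \<open>G x \<noteq> 0\<close> by (simp add: D_def h_def field_simps power2_eq_square)
    have "iter_step f \<alpha> m p x - \<alpha> = h - 2 * M * (h * F x / G x) * (1 + M * p * (h * F x / G x)) / D x"
      using elim by (simp add: iter_step_def quot denom M_def h_def)
    also have "\<dots> = h * ((G x)\<^sup>2 * D x - 2 * M * F x * G x - 2 * M\<^sup>2 * p * h * (F x)\<^sup>2) / ((G x)\<^sup>2 * D x)"
      using \<open>G x \<noteq> 0\<close> \<open>D x \<noteq> 0\<close> by (simp add: field_simps power2_eq_square)
    also have "(G x)\<^sup>2 * D x - 2 * M * F x * G x - 2 * M\<^sup>2 * p * h * (F x)\<^sup>2 =
        (1 + M) * (G x)\<^sup>2 - M * H x * F x - 2 * M * F x * G x + 2 * M * p * h * F x * (G x - M * F x)"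
      unfolding GD by (simp add: algebra_simps power2_eq_square)
    also have "\<dots> = h\<^sup>2 * P x"
      unfolding F_def G_def H_def P_def h_def by (rule numerator_factorization)
    finally show ?case
      using \<open>h \<noteq> 0\<close> by (simp add: h_def power3_eq_cube power2_eq_square)
  qed
  then show "((\<lambda>x. (iter_step f \<alpha> m p x - \<alpha>) / (x - \<alpha>) ^ 3) \<longlongrightarrow> ?L) (at \<alpha>)"
    using lim by (rule Lim_transform_eventually[rotated])
qed

section \<open>Convergence of the iteration\<close>

text \<open>
  With \<open>C\<close> slightly above \<open>norm L\<close>, every step near \<open>\<alpha>\<close> satisfies
  \<open>norm (g x - \<alpha>) \<le> C * norm (x - \<alpha>) ^ 3\<close>. On a small enough ball this at least halves the
  distance to \<open>\<alpha>\<close>, so the iterates never leave the ball and converge; any property \<open>Q\<close>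
  that holds throughout the ball is inherited by all of them.
\<close>

lemma local_cubic_convergence:
  fixes g :: "'a::real_normed_field \<Rightarrow> 'a"
  assumes "g \<alpha> = \<alpha>" and lim: "((\<lambda>x. (g x - \<alpha>) / (x - \<alpha>) ^ 3) \<longlongrightarrow> L) (at \<alpha>)"
    and good: "\<forall>\<^sub>F x in nhds \<alpha>. Q x"
  shows "\<exists>\<delta>>0. \<forall>x. dist (x 0) \<alpha> < \<delta> \<and> (\<forall>k. x (Suc k) = g (x k)) \<longrightarrow>
     (\<forall>k. Q (x k)) \<and> cubically_convergent x \<alpha> \<and>
     ((\<forall>k. x k \<noteq> \<alpha>) \<longrightarrow> (\<lambda>k. norm ((x (Suc k) - \<alpha>) / (x k - \<alpha>) ^ 3)) \<longlonglongrightarrow> norm L)"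
proof -
  define C where "C = norm L + 1"
  have "C > 0"
    by (simp add: C_def add_nonneg_pos)
  have "\<forall>\<^sub>F x in at \<alpha>. norm ((g x - \<alpha>) / (x - \<alpha>) ^ 3) < C"
    using order_tendstoD(2)[OF tendsto_norm[OF lim]] by (simp add: C_def)
  then have "\<forall>\<^sub>F x in nhds \<alpha>. x \<noteq> \<alpha> \<longrightarrow> norm ((g x - \<alpha>) / (x - \<alpha>) ^ 3) < C"
    by (simp add: eventually_at_filter)
  with good have "\<forall>\<^sub>F x in nhds \<alpha>. Q x \<and> (x \<noteq> \<alpha> \<longrightarrow> norm ((g x - \<alpha>) / (x - \<alpha>) ^ 3) < C)"
    by (rule eventually_conj)
  then obtain d where "d > 0" and d: "\<And>x. dist x \<alpha> < d \<Longrightarrow> Q x"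
    "\<And>x. x \<noteq> \<alpha> \<Longrightarrow> dist x \<alpha> < d \<Longrightarrow> norm ((g x - \<alpha>) / (x - \<alpha>) ^ 3) < C"
    unfolding eventually_nhds_metric by blast
  have cubic: "norm (g x - \<alpha>) \<le> C * norm (x - \<alpha>) ^ 3" if "dist x \<alpha> < d" for x
  proof (cases "x = \<alpha>")
    case True
    then show ?thesis
      using \<open>g \<alpha> = \<alpha>\<close> by simp
  next
    case False
    then show ?thesis
      using d(2)[OF False that] by (simp add: norm_divide norm_power field_simps)
  qed
  \<comment> \<open>with \<open>norm (x - \<alpha>) \<le> 1\<close> and \<open>C * \<delta> \<le> 1 / 2\<close> the cubic bound is at most half the distance\<close>
  define \<delta> where "\<delta> = min d (min 1 (1 / (2 * C)))"
  have "\<delta> > 0" "\<delta> \<le> d" "\<delta> \<le> 1" and "\<delta> \<le> 1 / (2 * C)"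
    using \<open>d > 0\<close> \<open>C > 0\<close> by (auto simp: \<delta>_def)
  then have "C * \<delta> \<le> 1 / 2"
    using \<open>C > 0\<close> by (simp add: field_simps)
  have half: "norm (g x - \<alpha>) \<le> norm (x - \<alpha>) / 2" if "dist x \<alpha> < \<delta>" for x
  proof -
    have *: "norm (x - \<alpha>) \<le> \<delta>" "norm (x - \<alpha>) \<le> 1"
      using that \<open>\<delta> \<le> 1\<close> by (auto simp: dist_norm)
    have "norm (g x - \<alpha>) \<le> C * norm (x - \<alpha>) ^ 3"
      using cubic that \<open>\<delta> \<le> d\<close> by simp
    also have "\<dots> = C * (norm (x - \<alpha>) * norm (x - \<alpha>)) * norm (x - \<alpha>)"
      by (simp add: power3_eq_cube)
    also have "\<dots> \<le> C * (\<delta> * 1) * norm (x - \<alpha>)"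
      using * \<open>C > 0\<close> \<open>\<delta> > 0\<close> by (intro mult_right_mono mult_left_mono mult_mono) auto
    also have "\<dots> \<le> 1 / 2 * norm (x - \<alpha>)"
      using \<open>C * \<delta> \<le> 1 / 2\<close> by (intro mult_right_mono) auto
    finally show ?thesis
      by simp
  qed
  have "(\<forall>k. Q (x k)) \<and> cubically_convergent x \<alpha> \<and>
     ((\<forall>k. x k \<noteq> \<alpha>) \<longrightarrow> (\<lambda>k. norm ((x (Suc k) - \<alpha>) / (x k - \<alpha>) ^ 3)) \<longlonglongrightarrow> norm L)"
    if x0: "dist (x 0) \<alpha> < \<delta>" and step: "\<And>k. x (Suc k) = g (x k)" for x
  proof -
    have geo: "norm (x k - \<alpha>) \<le> (1 / 2) ^ k * norm (x 0 - \<alpha>) \<and> dist (x k) \<alpha> < \<delta>" for k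
    proof (induction k)
      case 0
      then show ?case
        using x0 by simp
    next
      case (Suc k)
      then have "norm (x (Suc k) - \<alpha>) \<le> norm (x k - \<alpha>) / 2"
        using half step by simp
      with Suc show ?case
        unfolding dist_norm power_Suc using norm_ge_zero[of "x k - \<alpha>"] by linarith
    qed
    then have near: "dist (x k) \<alpha> < d" for k
      using \<open>\<delta> \<le> d\<close> less_le_trans by blast
    have conv: "x \<longlonglongrightarrow> \<alpha>"
    proof (rule LIM_zero_cancel, rule Lim_null_comparison)
      show "\<forall>\<^sub>F k in sequentially. norm (x k - \<alpha>) \<le> (1 / 2) ^ k * norm (x 0 - \<alpha>)"
        using geo by simp
      show "(\<lambda>k. (1 / 2) ^ k * norm (x 0 - \<alpha>)) \<longlonglongrightarrow> 0"
        by (intro tendsto_mult_left_zero LIMSEQ_power_zero) simp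
    qed
    have "(\<lambda>k. norm (x (Suc k) - \<alpha>)) \<in> O(\<lambda>k. norm (x k - \<alpha>) ^ 3)"
      using cubic[OF near] by (intro bigoI[of _ C]) (simp add: step norm_power)
    moreover have "(\<lambda>k. norm ((x (Suc k) - \<alpha>) / (x k - \<alpha>) ^ 3)) \<longlonglongrightarrow> norm L" if "\<forall>k. x k \<noteq> \<alpha>"
    proof -
      have "filterlim x (at \<alpha>) sequentially"
        using conv that by (simp add: filterlim_at)
      from tendsto_norm[OF filterlim_compose[OF lim this]] show ?thesis
        by (simp add: step)
    qed
    ultimately show ?thesis
      using d(1) near conv by (auto simp: cubically_convergent_def)
  qed
  with \<open>\<delta> > 0\<close> show ?thesis
    by blast
qed

lemma cubic_convergence:
  fixes f :: "'a::real_normed_field \<Rightarrow> 'a"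
  assumes "m \<ge> 1" "open U" "\<alpha> \<in> U" "times_differentiable_on (m + 2) f U"
    "zero_of_multiplicity f \<alpha> m"
  shows "\<exists>\<delta>>0. \<forall>x. dist (x 0) \<alpha> < \<delta> \<and> (\<forall>k. x (Suc k) = iter_step f \<alpha> m p (x k)) \<longrightarrow>
         well_defined_iterates f U \<alpha> m p x \<and>
         cubically_convergent x \<alpha> \<and>
         ((\<forall>k. x k \<noteq> \<alpha>) \<longrightarrow>
          (let B = taylor_coeff f \<alpha> in
           (\<lambda>k. norm ((x (Suc k) - \<alpha>) / (x k - \<alpha>) ^ 3)) \<longlonglongrightarrow>
             norm (p * B (m + 1) / (of_nat m * B m)
                   - B (m + 2) / (of_nat m * B m)
                   + (of_nat m + 1) * (B (m + 1))\<^sup>2 / (2 * (of_nat m)\<^sup>2 * (B m)\<^sup>2))))"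
proof -
  have "\<forall>\<^sub>F x in nhds \<alpha>. x \<in> U \<and> (x \<noteq> \<alpha> \<longrightarrow> deriv f x \<noteq> 0 \<and> step_denom f m p x \<noteq> 0)"
    using eventually_nhds_in_open[OF assms(2,3)] eventually_deriv_nonzero[OF assms]
      eventually_step_denom_nonzero[OF assms, of p]
    unfolding eventually_at_filter by eventually_elim simp
  from local_cubic_convergence[OF _ iter_step_error[OF assms, of p] this]
  show ?thesis
    unfolding Let_def well_defined_iterates_def by (simp only: iter_step_def[of f \<alpha> m p \<alpha>] simp_thms if_True)
qed

theorem theorem4:
  fixes m :: nat
  assumes "m \<ge> 1"
  shows "(\<forall>(f :: real \<Rightarrow> real) U \<alpha> p.
      open U \<and> \<alpha> \<in> U \<and> times_differentiable_on (m + 2) f U \<and>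
      zero_of_multiplicity f \<alpha> m \<longrightarrow>
      (\<exists>\<delta>>0. \<forall>x. dist (x 0) \<alpha> < \<delta> \<and> (\<forall>k. x (Suc k) = iter_step f \<alpha> m p (x k)) \<longrightarrow>
         well_defined_iterates f U \<alpha> m p x \<and>
         cubically_convergent x \<alpha> \<and>
         ((\<forall>k. x k \<noteq> \<alpha>) \<longrightarrow>
          (let B = taylor_coeff f \<alpha> in
           (\<lambda>k. norm ((x (Suc k) - \<alpha>) / (x k - \<alpha>) ^ 3)) \<longlonglongrightarrow>
             norm (p * B (m + 1) / (of_nat m * B m)
                   - B (m + 2) / (of_nat m * B m)
                   + (of_nat m + 1) * (B (m + 1))\<^sup>2 / (2 * (of_nat m)\<^sup>2 * (B m)\<^sup>2))))))
   \<and>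
   (\<forall>(f :: complex \<Rightarrow> complex) U \<alpha> p.
      open U \<and> \<alpha> \<in> U \<and> times_differentiable_on (m + 2) f U \<and>
      zero_of_multiplicity f \<alpha> m \<longrightarrow>
      (\<exists>\<delta>>0. \<forall>x. dist (x 0) \<alpha> < \<delta> \<and> (\<forall>k. x (Suc k) = iter_step f \<alpha> m p (x k)) \<longrightarrow>
         well_defined_iterates f U \<alpha> m p x \<and>
         cubically_convergent x \<alpha> \<and>
         ((\<forall>k. x k \<noteq> \<alpha>) \<longrightarrow>
          (let B = taylor_coeff f \<alpha> in
           (\<lambda>k. norm ((x (Suc k) - \<alpha>) / (x k - \<alpha>) ^ 3)) \<longlonglongrightarrow>
             norm (p * B (m + 1) / (of_nat m * B m)
                   - B (m + 2) / (of_nat m * B m)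
                   + (of_nat m + 1) * (B (m + 1))\<^sup>2 / (2 * (of_nat m)\<^sup>2 * (B m)\<^sup>2))))))"
  using cubic_convergence[where ?'a = real, OF assms] cubic_convergence[where ?'a = complex, OF assms]
  by blast

end
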